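(* Let $C$ be a row-finite $\omega\times\omega$ matrix over a field $\mathcal F$, and let $L=(L_k)_{k\in\omega}$ be the row-finite $\omega\times\omega$ matrix resulting from $C$ by the infinite Gauss-Jordan algorithm with rightmost pivots. Then $L$ is in lower row-reduced form.
   Context: $\omega=\{0,1,2,\dots\}$. $\mathcal F$ is a field and $\mathcal F^{(\omega)}$ is the space of sequences $(a_i)_{i\in\omega}$ in $\mathcal F$ with finitely many nonzero terms. A row-finite $\omega\times\omega$ matrix is a sequence $C=(C_n)_{n\in\omega}$ of rows $C_n\in\mathcal F^{(\omega)}$. For nonzero $x\in\mathcal F^{(\omega)}$ the length $\ell(x)$ is the largest index $i$ with $x_i\ne0$; $\ell(\mathbf 0)=-1$. Lower row-reduced form (LRRF): a row-finite matrix $A=(a_{ki})$ with set $J$ of indices of nonzero rows and $\rho_j=\ell(A_j)$ is in LRRF if (i) $a_{j\rho_j}=1$ for all $j\in J$, and (ii) $a_{k\rho_j}=0$ for all $j\in J$ and $k\in\omega$ with $k\neq j$. Infinite Gauss-Jordan algorithm with rightmost pivots applied to $C$. It produces vectors $L^{(i)}_n\in\mathcal F^{(\omega)}$ (entries $l^{(i)}_{nj}$) for $n\in\omega$, $i\ge -1$, and $G_n=L^{(n)}_n$, stage by stage for $n=0,1,2,\dots$. Stage $n$ uses the vectors $L^{(n-1)}_0,\dots,L^{(n-1)}_{n-1}$ of the previous stage: (1) Gaussian elimination: $L^{(-1)}_n=C_n$; for $i=0,1,\dots,n-1$ in this order, $L^{(i)}_n=L^{(i-1)}_n-l^{(i-1)}_{n\rho_i}L^{(n-1)}_i$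 with $\rho_i=\ell(L^{(n-1)}_i)$ if $L^{(n-1)}_i\ne\mathbf 0$, and $L^{(i)}_n=L^{(i-1)}_n$ if $L^{(n-1)}_i=\mathbf 0$. (2) Normalization: $L^{(n)}_n=G_n$, where $G_n$ is $L^{(n-1)}_n$ divided by its rightmost nonzero entry if $L^{(n-1)}_n\neq\mathbf 0$, and $G_n=\mathbf 0$ otherwise. (3) Jordan elimination: for $0\le i\le n-1$, $L^{(n)}_i=L^{(n-1)}_i-l^{(n-1)}_{i\rho_n}G_n$ with $\rho_n=\ell(G_n)$ if $G_n\neq\mathbf 0$, and $L^{(n)}_i=L^{(n-1)}_i$ if $G_n=\mathbf 0$. For each $k$ the sequence $(L^{(n)}_k)_{n\ge k}$ is eventually constant, and $L_k$ denotes its eventual value. *)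

theory Defs
  imports "HOL-Library.Poly_Mapping" Complex_Main
begin

text \<open>
  The finitely supported functions \<open>nat \<Rightarrow>\<^sub>0 'a\<close> are the space of
  sequences with finitely many nonzero terms, so row-finiteness of a matrix is built into its type:
  the entry in row \<open>k\<close> and column \<open>i\<close> of \<open>A\<close> is \<open>lookup (A k) i\<close>.
\<close>

type_synonym 'a row = "nat \<Rightarrow>\<^sub>0 'a"
type_synonym 'a rf_matrix = "nat \<Rightarrow> 'a row"

abbreviation entry :: "'a::zero row \<Rightarrow> nat \<Rightarrow> 'a" where
  "entry \<equiv> Poly_Mapping.lookup"

definition scale :: "'a::field \<Rightarrow> 'a row \<Rightarrow> 'a row" where
  "scale c x = Poly_Mapping.map (\<lambda>a. c * a) x"

lemma entry_scale [simp]: "entry (scale c x) i = c * entry x i"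
  unfolding scale_def by transfer (simp add: when_def)

definition row_length :: "'a::zero row \<Rightarrow> int" where
  "row_length x = (if x = 0 then -1 else int (Max {i. entry x i \<noteq> 0}))"

text \<open>The length as a column index; it is meaningful for nonzero rows only.\<close>

definition pivot :: "'a::zero row \<Rightarrow> nat" where
  "pivot x = nat (row_length x)"

definition LRRF :: "'a::field rf_matrix \<Rightarrow> bool" where
  "LRRF A \<longleftrightarrow>
     (let J = {j. A j \<noteq> 0} in
       (\<forall>j\<in>J. entry (A j) (pivot (A j)) = 1) \<and>
       (\<forall>j\<in>J. \<forall>k. k \<noteq> j \<longrightarrow> entry (A k) (pivot (A j)) = 0))"

definition eliminate :: "'a::field row \<Rightarrow> 'a row \<Rightarrow> 'a row" where
  "eliminate p x = (if p = 0 then x else x - scale (entry x (pivot p)) p)"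

definition normalize_row :: "'a::field row \<Rightarrow> 'a row" where
  "normalize_row x = (if x = 0 then 0 else scale (inverse (entry x (pivot x))) x)"

text \<open>
  Write \<open>L(n, k)\<close> for row \<open>k \<le> n\<close> after stage \<open>n\<close>. Within stage
  \<open>n\<close>, Gaussian elimination turns the input row \<open>x = C n\<close> into
  \<open>gauss_elim R x n\<close> where \<open>R i = L(n - 1, i)\<close> for \<open>i < n\<close>; the rows
  \<open>gauss_elim R x m\<close> with \<open>m < n\<close> are the intermediate results. The elimination
  coefficients are read off from the current intermediate row, not from \<open>x\<close>.
\<close>

primrec gauss_elim :: "'a::field rf_matrix \<Rightarrow> 'a row \<Rightarrow> nat \<Rightarrow> 'a row" where
  "gauss_elim R x 0 = x"
| "gauss_elim R x (Suc i) = eliminate (R i) (gauss_elim R x i)"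

text \<open>
  Stage \<open>n\<close> is performed in place: on entry, the rows of \<open>R\<close> with index below
  \<open>n\<close> are those produced by the previous stage, and the remaining ones are still the rows
  of the input matrix.
\<close>

definition gj_stage :: "nat \<Rightarrow> 'a::field rf_matrix \<Rightarrow> 'a rf_matrix" where
  "gj_stage n R =
     (let G = normalize_row (gauss_elim R (R n) n) in
       (\<lambda>k. if k < n then eliminate G (R k) else if k = n then G else R k))"

text \<open>
  The matrix after the stages \<open>0, \<dots>, n - 1\<close>, so that \<open>L(n, k)\<close> is
  \<open>gj_state C (Suc n) k\<close>.
\<close>

primrec gj_state :: "'a::field rf_matrix \<Rightarrow> nat \<Rightarrow> 'a rf_matrix" where
  "gj_state C 0 = C"
| "gj_state C (Suc n) = gj_stage n (gj_state C n)"

text \<open>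
  Each row is eventually constant, which makes the description below proper; this is not
  built into the definition.
\<close>

definition gauss_jordan :: "'a::field rf_matrix \<Rightarrow> 'a rf_matrix" where
  "gauss_jordan C k = (THE v. \<forall>\<^sub>F n in sequentially. gj_state C n k = v)"

end

theory Submission
  imports Defs
begin

text \<open>
  The algorithm never moves a pivot. Suppose that the rows processed so far are in lower row-reduced
  form. Gaussian elimination clears the new row at all their pivots, so the new normalized row
  \<open>G\<close> vanishes there, and its own pivot \<open>g\<close> is a new column. Jordan elimination then
  subtracts a multiple of \<open>G\<close> from an older row \<open>x\<close> only if \<open>x\<close> has a nonzero
  entry in column \<open>g\<close>. In that case \<open>g\<close> lies strictly to the left of the pivot of
  \<open>x\<close>, so neither the pivot of \<open>x\<close> nor the entry 1 in it is affected. Hence the reduced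
  form survives each stage (\<open>reduced_below_gj_stage\<close>), and the pivot of every row is
  permanent from the stage that creates it (\<open>pivot_gj_state\<close>).

  This is also why every row stabilizes although there are infinitely many stages. A stage that alters
  row \<open>k\<close> creates a row whose pivot is at most that of row \<open>k\<close>, and different rows have
  different pivots. So only finitely many stages alter row \<open>k\<close>
  (\<open>eventually_gj_state_eq\<close>). Each condition of the reduced form concerns at most two rows of
  the limit, and at a late enough stage both of them have reached their final values.
\<close>

section \<open>Pivots, elimination and normalization of rows\<close>

lemma entry_pivot_nonzero:
  assumes "x \<noteq> 0"
  shows "entry x (pivot x) \<noteq> 0"
proof -
  have "Max (Poly_Mapping.keys x) \<in> Poly_Mapping.keys x"
    using assms by (intro Max_in) auto
  then show ?thesis
    using assms by (simp add: pivot_def row_length_def keys.rep_eq)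
qed

lemma entry_beyond_pivot:
  assumes "pivot x < i"
  shows "entry x i = 0"
proof (rule ccontr)
  assume nz: "entry x i \<noteq> 0"
  then have "x \<noteq> 0" by auto
  moreover from nz have "i \<le> Max (Poly_Mapping.keys x)"
    by (intro Max_ge) (auto simp: in_keys_iff)
  ultimately show False
    using assms by (simp add: pivot_def row_length_def keys.rep_eq)
qed

lemma pivot_eqI:
  assumes "entry x p \<noteq> 0" and "\<And>i. p < i \<Longrightarrow> entry x i = 0"
  shows "pivot x = p"
proof (rule antisym)
  have "x \<noteq> 0" using assms(1) by auto
  then show "pivot x \<le> p"
    using entry_pivot_nonzero assms(2) not_le by blast
  show "p \<le> pivot x"
    using entry_beyond_pivot assms(1) not_le by blast
qed

lemma entry_eliminate:
  "entry (eliminate p x) i =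
     (if p = 0 then entry x i else entry x i - entry x (pivot p) * entry p i)"
  by (simp add: eliminate_def lookup_minus)

lemma eliminate_zero_right [simp]: "eliminate p 0 = 0"
  by (rule poly_mapping_eqI) (simp add: entry_eliminate)

lemma eliminate_eq_self:
  assumes "entry x (pivot p) = 0"
  shows "eliminate p x = x"
  using assms by (intro poly_mapping_eqI) (simp add: entry_eliminate)

lemma normalize_row_monic:
  assumes "normalize_row x \<noteq> 0"
  shows "entry (normalize_row x) (pivot (normalize_row x)) = 1"
proof -
  have x: "x \<noteq> 0" using assms by (auto simp: normalize_row_def)
  from entry_pivot_nonzero[OF x] have "pivot (normalize_row x) = pivot x"
    by (intro pivot_eqI) (auto simp: normalize_row_def x entry_beyond_pivot)
  then show ?thesis
    using entry_pivot_nonzero[OF x] by (simp add: normalize_row_def x)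
qed

text \<open>
  The step that keeps pivots in place. If \<open>x\<close> has a nonzero entry at the pivot of \<open>G\<close>,
  then that pivot lies to the left of the one of \<open>x\<close>, since \<open>G\<close> vanishes at the latter.
\<close>

lemma pivot_eliminate:
  assumes nz: "x \<noteq> 0" and G0: "entry G (pivot x) = 0"
  shows "pivot (eliminate G x) = pivot x"
    and "eliminate G x \<noteq> 0"
proof -
  have same: "entry (eliminate G x) (pivot x) = entry x (pivot x)"
    by (simp add: entry_eliminate G0)
  then show "eliminate G x \<noteq> 0"
    using entry_pivot_nonzero[OF nz] by auto
  show "pivot (eliminate G x) = pivot x"
  proof (rule pivot_eqI)
    show "entry (eliminate G x) (pivot x) \<noteq> 0"
      using same entry_pivot_nonzero[OF nz] by simp
  next
    fix i assume i: "pivot x < i"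
    show "entry (eliminate G x) i = 0"
    proof (cases "G = 0 \<or> entry x (pivot G) = 0")
      case True
      then show ?thesis
        using i by (auto simp: entry_eliminate entry_beyond_pivot)
    next
      case False
      then have "pivot G \<le> pivot x"
        using entry_beyond_pivot not_le by blast
      then show ?thesis
        using i by (simp add: entry_eliminate entry_beyond_pivot)
    qed
  qed
qed

section \<open>Invariance of the reduced form and of the pivots\<close>

text \<open>
  What the stages preserve: lower row-reduced form of the finitely many rows with index below
  \<open>n\<close>, which says nothing about the rows not processed yet.
\<close>

definition reduced_below :: "nat \<Rightarrow> 'a::field rf_matrix \<Rightarrow> bool" where
  "reduced_below n R \<longleftrightarrow>
     (\<forall>j<n. R j \<noteq> 0 \<longrightarrow> entry (R j) (pivot (R j)) = 1 \<and>
        (\<forall>k<n. k \<noteq> j \<longrightarrow> entry (R k) (pivot (R j)) = 0))"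

lemma reduced_belowD:
  assumes "reduced_below n R" "j < n" "R j \<noteq> 0"
  shows "entry (R j) (pivot (R j)) = 1"
    and "k < n \<Longrightarrow> k \<noteq> j \<Longrightarrow> entry (R k) (pivot (R j)) = 0"
  using assms by (auto simp: reduced_below_def)

text \<open>
  A zero once created is kept: the rows subtracted later vanish at the pivots of the earlier ones.
\<close>

lemma gauss_elim_clears_pivots:
  assumes red: "reduced_below n R" and "m \<le> n" and "j < m" and nz: "R j \<noteq> 0"
  shows "entry (gauss_elim R x m) (pivot (R j)) = 0"
  using \<open>m \<le> n\<close> \<open>j < m\<close>
proof (induction m)
  case (Suc m)
  then show ?case
    using reduced_belowD[OF red _ nz]
    by (cases "j = m") (auto simp: entry_eliminate nz)
qed simp

lemma gj_stage_new_row_clears_pivots: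
  assumes "reduced_below n R" "j < n" "R j \<noteq> 0"
  shows "entry (gj_stage n R n) (pivot (R j)) = 0"
  using gauss_elim_clears_pivots[OF assms(1) order_refl assms(2,3)]
  by (simp add: gj_stage_def Let_def normalize_row_def)

lemma gj_stage_old_row:
  assumes "k < n"
  shows "gj_stage n R k = eliminate (gj_stage n R n) (R k)"
  using assms by (simp add: gj_stage_def Let_def)

lemma pivot_gj_stage:
  assumes red: "reduced_below n R" and k: "k < n"
  shows "gj_stage n R k = 0 \<longleftrightarrow> R k = 0"
    and "R k \<noteq> 0 \<Longrightarrow> pivot (gj_stage n R k) = pivot (R k)"
proof -
  show "gj_stage n R k = 0 \<longleftrightarrow> R k = 0"
    using pivot_eliminate(2) gj_stage_new_row_clears_pivots[OF red k]
    by (cases "R k = 0") (auto simp: gj_stage_old_row[OF k])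
  show "pivot (gj_stage n R k) = pivot (R k)" if "R k \<noteq> 0"
    using pivot_eliminate(1) gj_stage_new_row_clears_pivots[OF red k] that
    by (auto simp: gj_stage_old_row[OF k])
qed

lemma reduced_below_gj_stage:
  assumes red: "reduced_below n R"
  shows "reduced_below (Suc n) (gj_stage n R)"
proof -
  let ?S = "gj_stage n R"
  have monic: "entry (?S n) (pivot (?S n)) = 1" if "?S n \<noteq> 0"
    using that normalize_row_monic[of "gauss_elim R (R n) n"]
    by (simp add: gj_stage_def Let_def)
  have "entry (?S j) (pivot (?S j)) = 1 \<and>
      (\<forall>k<Suc n. k \<noteq> j \<longrightarrow> entry (?S k) (pivot (?S j)) = 0)"
    if j: "j < Suc n" and nz: "?S j \<noteq> 0" for j
  proof (cases "j = n")
    case True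
    \<comment> \<open>Jordan elimination clears the pivot column of the new row in all older rows.\<close>
    have "entry (?S k) (pivot (?S n)) = 0" if "k < n" for k
      using that nz monic True by (simp add: gj_stage_old_row[OF that] entry_eliminate)
    with True show ?thesis
      using monic nz by (metis less_Suc_eq)
  next
    case False
    with j have jn: "j < n" by simp
    have Rj: "R j \<noteq> 0" and piv: "pivot (?S j) = pivot (R j)"
      using pivot_gj_stage[OF red jn] nz by auto
    \<comment> \<open>The new row vanishes in the old pivot columns, so these columns do not change.\<close>
    have new: "entry (?S n) (pivot (R j)) = 0"
      using gj_stage_new_row_clears_pivots[OF red jn Rj] .
    have old: "entry (?S k) (pivot (R j)) = entry (R k) (pivot (R j))" if "k < n" for k
      by (simp add: gj_stage_old_row[OF that] entry_eliminate new)
    have "entry (?S k) (pivot (R j)) = 0" if "k < Suc n" "k \<noteq> j" for k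
      using that new old reduced_belowD(2)[OF red jn Rj] by (cases "k = n") auto
    then show ?thesis
      using old[OF jn] reduced_belowD(1)[OF red jn Rj] by (simp add: piv)
  qed
  then show ?thesis by (simp add: reduced_below_def)
qed

lemma reduced_below_gj_state: "reduced_below n (gj_state C n)"
  by (induction n) (simp_all add: reduced_below_gj_stage, simp add: reduced_below_def)

text \<open>
  The pivot of row \<open>k\<close> is settled by stage \<open>k\<close>, which is the step from the state
  \<open>k\<close> to the state \<open>Suc k\<close>.
\<close>

lemma pivot_gj_state:
  assumes "k < n"
  shows "gj_state C n k = 0 \<longleftrightarrow> gj_state C (Suc k) k = 0"
    and "gj_state C n k \<noteq> 0 \<Longrightarrow> pivot (gj_state C n k) = pivot (gj_state C (Suc k) k)"
proof -
  have "(gj_state C n k = 0 \<longleftrightarrow> gj_state C (Suc k) k = 0) \<and>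
      (gj_state C n k \<noteq> 0 \<longrightarrow> pivot (gj_state C n k) = pivot (gj_state C (Suc k) k))"
    using Suc_leI[OF assms]
  proof (induction n rule: dec_induct)
    case base
    show ?case by blast
  next
    case (step n)
    then show ?case
      using pivot_gj_stage[OF reduced_below_gj_state, of k n C]
      by (simp del: gj_state.simps add: gj_state.simps(2)[of C n])
  qed
  then show "gj_state C n k = 0 \<longleftrightarrow> gj_state C (Suc k) k = 0"
    and "gj_state C n k \<noteq> 0 \<Longrightarrow> pivot (gj_state C n k) = pivot (gj_state C (Suc k) k)"
    by blast+
qed

section \<open>Stabilization of the rows and the limit matrix\<close>

lemma inj_on_pivots_created:
  "inj_on (\<lambda>n. pivot (gj_state C (Suc n) n)) {n. gj_state C (Suc n) n \<noteq> 0}"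
proof (rule inj_onI, rule ccontr)
  fix i j
  assume nz: "i \<in> {n. gj_state C (Suc n) n \<noteq> 0}" "j \<in> {n. gj_state C (Suc n) n \<noteq> 0}"
    and eq: "pivot (gj_state C (Suc i) i) = pivot (gj_state C (Suc j) j)"
    and neq: "i \<noteq> j"
  define n where "n = Suc (max i j)"
  have lt: "i < n" "j < n" by (auto simp: n_def)
  have ni: "gj_state C n i \<noteq> 0" and nj: "gj_state C n j \<noteq> 0"
    using nz pivot_gj_state(1)[OF lt(1)] pivot_gj_state(1)[OF lt(2)] by auto
  have "pivot (gj_state C n i) = pivot (gj_state C n j)"
    using eq pivot_gj_state(2)[OF lt(1) ni] pivot_gj_state(2)[OF lt(2) nj] by simp
  then show False
    using reduced_belowD(1)[OF reduced_below_gj_state lt(1) ni]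
      reduced_belowD(2)[OF reduced_below_gj_state lt(2) nj lt(1) neq] by simp
qed

text \<open>
  A stage that alters row \<open>k\<close> must create a row whose pivot does not exceed that of row
  \<open>k\<close>. As that bound is permanent and the pivots created are distinct, this happens finitely often.
\<close>

lemma eventually_gj_state_eq:
  "\<exists>v. \<forall>\<^sub>F n in sequentially. gj_state C n k = v"
proof -
  let ?p = "\<lambda>n. pivot (gj_state C (Suc n) n)"
  let ?N = "{n. gj_state C (Suc n) n \<noteq> 0 \<and> ?p n \<le> ?p k}"
  have "finite (?p ` ?N)"
    by (rule finite_subset[of _ "{..?p k}"]) auto
  moreover have "inj_on ?p ?N"
    by (rule inj_on_subset[OF inj_on_pivots_created]) blast
  ultimately have "finite ?N"
    by (rule finite_imageD)
  then obtain b where b: "\<forall>n\<in>?N. n \<le> b"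
    using finite_nat_set_iff_bounded_le by auto
  define m where "m = Suc (max b k)"
  have keep: "gj_state C (Suc n) k = gj_state C n k" if n: "m \<le> n" for n
  proof -
    have kn: "k < n" and "n \<notin> ?N" using n b by (auto simp: m_def)
    then have big: "gj_state C (Suc n) n = 0 \<or> ?p k < ?p n" by auto
    have step: "gj_state C (Suc n) k = eliminate (gj_state C (Suc n) n) (gj_state C n k)"
      using gj_stage_old_row[OF kn] by simp
    show ?thesis
    proof (cases "gj_state C (Suc n) n = 0 \<or> gj_state C n k = 0")
      case True
      then show ?thesis unfolding step by (auto simp: eliminate_def[of 0])
    next
      case False
      then have "pivot (gj_state C n k) < ?p n"
        using big pivot_gj_state(2)[OF kn, of C] by auto
      then show ?thesis
        unfolding step by (intro eliminate_eq_self entry_beyond_pivot)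
    qed
  qed
  have "gj_state C n k = gj_state C m k" if "m \<le> n" for n
    using that by (induction n rule: dec_induct) (simp_all only: keep)
  then show ?thesis
    unfolding eventually_sequentially by blast
qed

lemma eventually_gj_state_eq_gauss_jordan:
  "\<forall>\<^sub>F n in sequentially. gj_state C n k = gauss_jordan C k"
proof -
  have "\<exists>!v. \<forall>\<^sub>F n in sequentially. gj_state C n k = v"
  proof (rule ex_ex1I)
    fix v w
    assume "\<forall>\<^sub>F n in sequentially. gj_state C n k = v"
      and "\<forall>\<^sub>F n in sequentially. gj_state C n k = w"
    then have "\<forall>\<^sub>F n in sequentially. v = w"
      by eventually_elim simp
    then show "v = w" by simp
  qed (rule eventually_gj_state_eq)
  then show ?thesis
    unfolding gauss_jordan_def by (rule theI')
qed

theorem theorem35: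
  fixes C :: "'a::field rf_matrix"
  shows "LRRF (gauss_jordan C)"
proof -
  have reduced: "entry (gauss_jordan C j) (pivot (gauss_jordan C j)) = 1 \<and>
      (k \<noteq> j \<longrightarrow> entry (gauss_jordan C k) (pivot (gauss_jordan C j)) = 0)"
    if nz: "gauss_jordan C j \<noteq> 0" for j k
  proof -
    have "\<forall>\<^sub>F n in sequentially. gj_state C n j = gauss_jordan C j \<and>
        gj_state C n k = gauss_jordan C k \<and> j < n \<and> k < n"
      by (intro eventually_conj eventually_gj_state_eq_gauss_jordan eventually_gt_at_top)
    then obtain n where "gj_state C n j = gauss_jordan C j" "gj_state C n k = gauss_jordan C k"
        "j < n" "k < n"
      by (auto dest: eventually_happens)
    then show ?thesis
      using reduced_belowD[OF reduced_below_gj_state, of j n C] nz by metis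
  qed
  then show ?thesis
    unfolding LRRF_def Let_def by blast
qed

end
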